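(* Let $\kappa$ be a regular uncountable cardinal. Then the class of $\kappa$-regular trees with $\kappa$ many tops contains a minor-antichain of size $\kappa$; that is, there is a family $(G_i)_{i<\kappa}$ of $\kappa$-regular trees with $\kappa$ many tops such that $G_i$ is not a minor of $G_j$ for all distinct $i,j<\kappa$.
   Context: Graphs are simple, undirected and possibly infinite. A graph $H$ is a minor of a graph $G$, written $H\preccurlyeq G$, if to every vertex $x\in H$ one can assign a (nonempty, possibly infinite) connected set $V_x\subseteq V(G)$, the branch set of $x$, so that the sets $V_x$ are pairwise disjoint and $G$ contains an edge between $V_x$ and $V_y$ whenever $xy$ is an edge of $H$. Trees with tops: Let $\kappa$ be an uncountable cardinal. Let $S\subseteq\kappa$ be a set consisting only of ordinals of cofinality $\omega$, and for each $s\in S$ choose a cofinal sequence $f_s\colon\omega\to s$ (i.e. a function whose range is unbounded in $s$). Let $F(S)=\{f_s : s\in S\}$, a collection of $\omega$-sequences of elements of $\kappa$. The graph $G(S)$ (which depends also on the choice of the sequences $f_s$) has as vertex set $T^S$ the set of all finite sequences of elements of $\kappa$ (including the empty sequence) together with all elements of $F(S)$. Its edges are as follows: each finite sequence of length $n$ is adjacent to all sequences of length $n+1$ extending it, and each $f_s\in F(S)$ is adjacent to all of its finite initial segments (including the empty sequence); there are no other edges. Such a graph $G(S)$ is called a $\kappa$-regular tree with tops, and the elements of $F(S)$ are its tops. It has $\kappa$ many tops if $|F(S)|=\kappa$ (equivalently $|S|=\kappa$). *)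

theory Defs
  imports "Graph_Theory.Graph_Theory"
begin

unbundle cardinal_syntax

text \<open>
  Simple undirected graphs, possibly infinite, are represented as in \<open>Graph_Theory\<close>: a
  \<open>pair_pre_digraph\<close> satisfying the locale \<open>pair_bidirected_digraph\<close> (symmetric, loop-free, and
  without parallel arcs by construction). On these, \<open>connected\<close> is ordinary graph connectivity;
  note that it includes non-emptiness of the vertex set.
\<close>

definition minor :: "'v pair_pre_digraph \<Rightarrow> 'w pair_pre_digraph \<Rightarrow> bool"  (infix \<open>\<preceq>\<^sub>m\<close> 50) where
  "H \<preceq>\<^sub>m G \<longleftrightarrow> (\<exists>V :: 'v \<Rightarrow> 'w set.
     (\<forall>x \<in> pverts H. V x \<noteq> {} \<and> V x \<subseteq> pverts G \<and> connected (with_proj G \<restriction> V x)) \<and>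
     (\<forall>x \<in> pverts H. \<forall>y \<in> pverts H. x \<noteq> y \<longrightarrow> V x \<inter> V y = {}) \<and>
     (\<forall>(x, y) \<in> parcs H. \<exists>u \<in> V x. \<exists>v \<in> V y. (u, v) \<in> parcs G))"

text \<open>
  A cardinal is a relation \<open>\<kappa>\<close> with \<open>Card_order \<kappa>\<close>; its elements (the ordinals below it) are the
  elements of \<open>Field \<kappa>\<close>, and the ordinal \<open>s \<in> Field \<kappa>\<close>, viewed as a set of ordinals, is
  \<open>underS \<kappa> s\<close>. For \<open>s\<close> without a largest element, a subset of \<open>s\<close> is cofinal in the sense below
  iff it is unbounded in \<open>s\<close>.
\<close>

definition cofinal_below :: "'a rel \<Rightarrow> 'a \<Rightarrow> 'a set \<Rightarrow> bool" where
  "cofinal_below r s A \<longleftrightarrow> A \<subseteq> underS r s \<and> (\<forall>a \<in> underS r s. \<exists>b \<in> A. (a, b) \<in> r)"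

text \<open>
  The least cardinality of a cofinal subset of \<open>s\<close> is \<open>\<omega>\<close>. Successors and the least element are
  excluded, since they have finite cofinal subsets.
\<close>

definition cofinality_omega :: "'a rel \<Rightarrow> 'a \<Rightarrow> bool" where
  "cofinality_omega r s \<longleftrightarrow>
     (\<exists>A. cofinal_below r s A \<and> |A| =o natLeq) \<and>
     (\<forall>A. cofinal_below r s A \<longrightarrow> natLeq \<le>o |A| )"

datatype 'a tree_vertex = Fin "'a list" | Top "nat \<Rightarrow> 'a"

definition tree_with_tops ::
    "'a rel \<Rightarrow> 'a set \<Rightarrow> ('a \<Rightarrow> nat \<Rightarrow> 'a) \<Rightarrow> 'a tree_vertex pair_pre_digraph" where
  "tree_with_tops \<kappa> S f =
     (let E = {(Fin xs, Fin (xs @ [a])) | xs a. xs \<in> lists (Field \<kappa>) \<and> a \<in> Field \<kappa>} \<union>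
              {(Top (f s), Fin (map (f s) [0..<n])) | s n. s \<in> S}
      in \<lparr> pverts = Fin ` lists (Field \<kappa>) \<union> Top ` f ` S, parcs = E \<union> E\<inverse> \<rparr>)"

text \<open>The values of \<open>f\<close> outside \<open>S\<close> are irrelevant.\<close>

definition tops_data :: "'a rel \<Rightarrow> 'a set \<Rightarrow> ('a \<Rightarrow> nat \<Rightarrow> 'a) \<Rightarrow> bool" where
  "tops_data \<kappa> S f \<longleftrightarrow> S \<subseteq> Field \<kappa> \<and>
     (\<forall>s \<in> S. cofinality_omega \<kappa> s \<and> cofinal_below \<kappa> s (range (f s)))"

definition regular_trees_with_many_tops :: "'a rel \<Rightarrow> 'a tree_vertex pair_pre_digraph set" where
  "regular_trees_with_many_tops \<kappa> =
     {tree_with_tops \<kappa> S f | S f. tops_data \<kappa> S f \<and> |f ` S| =o \<kappa>}"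

lemma tree_with_tops_simple_graph:
  assumes "tops_data \<kappa> S f"
  shows "pair_bidirected_digraph (tree_with_tops \<kappa> S f)"
proof
  have f: "f s n \<in> Field \<kappa>" if "s \<in> S" for s n
    using assms that
    by (fastforce simp: tops_data_def cofinal_below_def underS_def Field_def)
  show "fst e \<in> pverts (tree_with_tops \<kappa> S f)" "snd e \<in> pverts (tree_with_tops \<kappa> S f)"
    if "e \<in> parcs (tree_with_tops \<kappa> S f)" for e
    using that f by (auto simp: tree_with_tops_def Let_def lists_eq_set intro!: imageI)
  show "symmetric (with_proj (tree_with_tops \<kappa> S f))"
    by (auto simp: symmetric_def tree_with_tops_def Let_def intro!: symI)
  show "fst e \<noteq> snd e" if "e \<in> parcs (tree_with_tops \<kappa> S f)" for e
    using that by (auto simp: tree_with_tops_def Let_def)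
qed

end

theory Submission
  imports Defs "HOL-Library.Sublist"
begin

text \<open>
  Order the vertices of a tree with tops by extension, each top lying above its finite initial
  segments. Adjacent vertices are comparable, and the vertices below a given one form a chain, so
  every connected set of vertices has a least element (\<open>connected_has_least\<close>). A minor embedding of
  \<open>G(S)\<close> into \<open>G(R)\<close> can therefore be replaced by the map \<open>t\<close> that sends a vertex to the least
  element of its branch set: \<open>t\<close> is injective, and it maps adjacent vertices to comparable ones
  (\<open>minor_root_map\<close>).

  Such a \<open>t\<close> maps finite sequences to finite sequences, since a top has only countably many vertices
  below it but a finite sequence has \<open>\<kappa>\<close> many neighbours. For all \<open>s\<close> in a club of \<open>\<kappa>\<close>, the finite
  sequences over \<open>s\<close> are mapped to finite sequences over \<open>s\<close>, while neither a finite sequence over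
  \<open>s\<close> nor a top \<open>g r\<close> with \<open>r < s\<close> is the image of the top \<open>f s\<close>. For such an \<open>s \<in> S\<close>, the image of
  \<open>f s\<close> is comparable to infinitely many finite sequences over \<open>s\<close> and below none of them. So it is a
  top \<open>g r\<close> with all values below \<open>s\<close>, hence \<open>r \<le> s\<close>, hence \<open>r = s\<close> and \<open>s \<in> R\<close>. Thus \<open>S - R\<close> is not
  stationary (\<open>minor_tops_difference_nonstationary\<close>).

  It remains to find \<open>\<kappa>\<close> many pairwise disjoint stationary sets of ordinals of cofinality \<open>\<omega>\<close>, which
  is the case of Solovay's splitting theorem that has an elementary proof (\<open>stationary_split\<close>): for
  some \<open>n\<close>, the \<open>n\<close>-th entries of cofinal \<open>\<omega>\<close>-sequences are unbounded on stationary sets, and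
  Fodor's pressing down lemma makes them constant on stationary sets, with unboundedly many constants.
\<close>

section \<open>The tree order and branch sets\<close>

fun tree_le :: "'a tree_vertex \<Rightarrow> 'a tree_vertex \<Rightarrow> bool" where
  "tree_le (Fin xs) (Fin ys) \<longleftrightarrow> prefix xs ys"
| "tree_le (Fin xs) (Top g) \<longleftrightarrow> xs = map g [0..<length xs]"
| "tree_le (Top g) v \<longleftrightarrow> v = Top g"

definition tree_comparable :: "'a tree_vertex \<Rightarrow> 'a tree_vertex \<Rightarrow> bool" where
  "tree_comparable u v \<longleftrightarrow> tree_le u v \<or> tree_le v u"

lemma tree_le_refl: "tree_le u u"
  by (cases u) auto

lemma prefix_map_upt: "m \<le> n \<Longrightarrow> prefix (map g [0..<m]) (map g [0..<n])"
  by (metis le_Suc_ex map_append prefixI upt_add_eq_append zero_le)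

lemma prefix_of_map_upt:
  assumes "prefix xs (map g [0..<n])"
  shows "xs = map g [0..<length xs]"
proof -
  have "xs = take (length xs) (map g [0..<n])"
    using assms by (auto elim: prefixE)
  also have "\<dots> = map g [0..<length xs]"
    using prefix_length_le[OF assms] by (simp add: take_map)
  finally show ?thesis .
qed

lemma tree_le_trans: "tree_le u v \<Longrightarrow> tree_le v w \<Longrightarrow> tree_le u w"
proof (cases u; cases v; cases w)
  fix xs ys g assume *: "u = Fin xs" "v = Fin ys" "w = Top g" "tree_le u v" "tree_le v w"
  then have "prefix xs (map g [0..<length ys])" by simp
  from prefix_of_map_upt[OF this] show ?thesis using * by simp
qed auto

lemma tree_le_forest:
  assumes "tree_le u w" "tree_le v w"
  shows "tree_comparable u v"
proof (cases w)
  case (Fin ws)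
  then show ?thesis
    using assms prefix_same_cases by (cases u; cases v) (auto simp: tree_comparable_def)
next
  case (Top g)
  show ?thesis
  proof (cases "\<exists>xs ys. u = Fin xs \<and> v = Fin ys")
    case True
    then obtain xs ys where uv: "u = Fin xs" "v = Fin ys" by blast
    then have "xs = map g [0..<length xs]" "ys = map g [0..<length ys]"
      using assms Top by auto
    then have "prefix xs ys \<or> prefix ys xs"
      by (metis prefix_map_upt nat_le_linear)
    then show ?thesis using uv by (simp add: tree_comparable_def)
  next
    case False
    then show ?thesis
      using assms Top by (cases u; cases v) (auto simp: tree_comparable_def)
  qed
qed

lemma tree_arcs_comparable:
  "(u, v) \<in> parcs (tree_with_tops \<kappa> S f) \<Longrightarrow> tree_comparable u v"
  by (auto simp: tree_with_tops_def Let_def tree_comparable_def)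

text \<open>
  A finite sequence of minimal length is minimal; in a set of tops every element is.
\<close>

lemma tree_minimal_exists:
  assumes "V \<noteq> {}"
  shows "\<exists>t \<in> V. \<forall>v \<in> V. tree_le v t \<longrightarrow> v = t"
proof (cases "\<exists>xs. Fin xs \<in> V")
  case True
  then obtain xs where xs: "Fin xs \<in> V" and least: "\<And>ys. Fin ys \<in> V \<Longrightarrow> length xs \<le> length ys"
    using ex_has_least_nat[of "\<lambda>xs. Fin xs \<in> V" _ length] by blast
  have "v = Fin xs" if "v \<in> V" "tree_le v (Fin xs)" for v
  proof (cases v)
    case (Fin ys)
    then show ?thesis
      using that least[of ys] by (auto simp: prefix_def)
  qed (use that in auto)
  then show ?thesis using xs by blast
next
  case False
  obtain t where "t \<in> V" using assms by blast
  moreover have "v = t" if "v \<in> V" "tree_le v t" for v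
    using that False by (cases v) auto
  ultimately show ?thesis by blast
qed

lemma connected_induct:
  assumes conn: "connected (with_proj G \<restriction> V)"
    and "t \<in> V" "v \<in> V" "P t"
    and step: "\<And>u v. u \<in> V \<Longrightarrow> v \<in> V \<Longrightarrow> (u, v) \<in> parcs G \<or> (v, u) \<in> parcs G \<Longrightarrow> P u \<Longrightarrow> P v"
  shows "P v"
proof -
  let ?H = "mk_symmetric (with_proj G \<restriction> V)"
  have "(t, v) \<in> rtrancl_on (pverts ?H) (parcs ?H)"
    using conn assms(2,3)
    by (auto simp: connected_def strongly_connected_def reachable_def)
  then show ?thesis
    using \<open>P t\<close>
  proof (induction rule: rtrancl_on.induct)
    case (rtrancl_on_into_rtrancl_on u w x)
    then show ?case
      using step[of w x] by (auto simp: parcs_mk_symmetric)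
  qed
qed

text \<open>
  A minimal element \<open>t\<close> is least, because being above \<open>t\<close> spreads along the edges: if \<open>u\<close> is above
  \<open>t\<close> and the next vertex \<open>v\<close> is below \<open>u\<close>, then \<open>t\<close> and \<open>v\<close> belong to the chain below \<open>u\<close>, and by
  minimality \<open>v\<close> is not strictly below \<open>t\<close>.
\<close>

lemma connected_has_least:
  assumes comp: "\<And>u v. (u, v) \<in> parcs G \<Longrightarrow> tree_comparable u v"
    and conn: "connected (with_proj G \<restriction> V)"
    and ne: "V \<noteq> {}"
  shows "\<exists>t \<in> V. \<forall>v \<in> V. tree_le t v"
proof -
  obtain t where t: "t \<in> V" and min: "\<And>v. v \<in> V \<Longrightarrow> tree_le v t \<Longrightarrow> v = t"
    using tree_minimal_exists[OF ne] by blast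
  have "tree_le t v" if "v \<in> V" for v
    using conn t that tree_le_refl
  proof (rule connected_induct)
    fix u v assume *: "u \<in> V" "v \<in> V" "(u, v) \<in> parcs G \<or> (v, u) \<in> parcs G" "tree_le t u"
    then have "tree_le u v \<or> tree_le v u"
      using comp by (auto simp: tree_comparable_def)
    then show "tree_le t v"
    proof
      assume "tree_le v u"
      then have "tree_comparable t v" using *(4) tree_le_forest by blast
      then show ?thesis
        using min[OF *(2)] tree_le_refl by (auto simp: tree_comparable_def)
    qed (use * tree_le_trans in blast)
  qed
  then show ?thesis using t by blast
qed

text \<open>
  The least elements of two branch sets joined by an edge are comparable: both lie below the larger
  endpoint of that edge.
\<close>

lemma minor_root_map:
  assumes comp: "\<And>u v. (u, v) \<in> parcs G \<Longrightarrow> tree_comparable u v"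
    and H: "pair_wf_digraph H"
    and minor: "H \<preceq>\<^sub>m G"
  shows "\<exists>t. inj_on t (pverts H) \<and> t ` pverts H \<subseteq> pverts G \<and>
    (\<forall>x y. (x, y) \<in> parcs H \<longrightarrow> tree_comparable (t x) (t y))"
proof -
  from minor obtain V
    where V: "\<forall>x \<in> pverts H. V x \<noteq> {} \<and> V x \<subseteq> pverts G \<and> connected (with_proj G \<restriction> V x)"
      and disj: "\<forall>x \<in> pverts H. \<forall>y \<in> pverts H. x \<noteq> y \<longrightarrow> V x \<inter> V y = {}"
      and edge: "\<forall>(x, y) \<in> parcs H. \<exists>u \<in> V x. \<exists>v \<in> V y. (u, v) \<in> parcs G"
    unfolding minor_def by (elim exE conjE)
  have "\<exists>t \<in> V x. \<forall>v \<in> V x. tree_le t v" if "x \<in> pverts H" for x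
    using connected_has_least[OF comp, where V = "V x"] V that by blast
  then obtain t where t: "\<And>x. x \<in> pverts H \<Longrightarrow> t x \<in> V x"
    and least: "\<And>x v. x \<in> pverts H \<Longrightarrow> v \<in> V x \<Longrightarrow> tree_le (t x) v"
    by metis
  show ?thesis
  proof (intro exI conjI allI impI)
    show "inj_on t (pverts H)"
    proof (rule inj_onI)
      fix x y assume xy: "x \<in> pverts H" "y \<in> pverts H" "t x = t y"
      then have "t x \<in> V x \<inter> V y"
        using t[of x] t[of y] by simp
      then show "x = y"
        using disj xy by blast
    qed
    show "t ` pverts H \<subseteq> pverts G"
      using t V by blast
  next
    fix x y assume xy: "(x, y) \<in> parcs H"
    then have x: "x \<in> pverts H" and y: "y \<in> pverts H"
      using H by (auto simp: pair_wf_digraph_def)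
    obtain u v where u: "u \<in> V x" and v: "v \<in> V y" and "(u, v) \<in> parcs G"
      using edge xy by blast
    then have "tree_le u v \<or> tree_le v u"
      using comp by (auto simp: tree_comparable_def)
    then show "tree_comparable (t x) (t y)"
      using least[OF x u] least[OF y v] tree_le_trans tree_le_forest by blast
  qed
qed

section \<open>Stationary sets\<close>

definition closed_at :: "'a rel \<Rightarrow> ('a \<Rightarrow> 'a set) \<Rightarrow> 'a \<Rightarrow> bool" where
  "closed_at r B s \<longleftrightarrow> (\<forall>b \<in> underS r s. B b \<subseteq> underS r s)"

definition small_valued :: "'a rel \<Rightarrow> ('a \<Rightarrow> 'a set) \<Rightarrow> bool" where
  "small_valued r B \<longleftrightarrow> (\<forall>b \<in> Field r. B b \<subseteq> Field r \<and> |B b| <o r)"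

text \<open>
  For a regular uncountable \<open>r\<close>, the points closed under a small-valued \<open>B\<close> form a club. Conversely,
  a club \<open>C\<close> contains each point other than \<open>0\<close> that is closed under the map sending \<open>b\<close> to the next
  element of \<open>C\<close> above \<open>b\<close>. So for sets that do not contain \<open>0\<close> this is the usual notion,
  phrased by closure operations so that intersections of clubs become unions of values.
\<close>

definition stationary :: "'a rel \<Rightarrow> 'a set \<Rightarrow> bool" where
  "stationary r W \<longleftrightarrow> (\<forall>B. small_valued r B \<longrightarrow> (\<exists>s \<in> W. closed_at r B s))"

lemma stationary_mono: "stationary r W \<Longrightarrow> W \<subseteq> W' \<Longrightarrow> stationary r W'"
  unfolding stationary_def by blast

locale regular_uncountable =
  fixes \<kappa> :: "'a rel"
  assumes card_order: "Card_order \<kappa>"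
    and uncountable: "natLeq <o \<kappa>"
    and regular: "regularCard \<kappa>"
begin

lemma well_order: "Well_order \<kappa>"
  using card_order card_order_on_well_order_on by blast

lemma cinfinite: "Cinfinite \<kappa>"
  using cinfinite_mono[OF ordLess_imp_ordLeq[OF uncountable] natLeq_cinfinite] card_order by simp

lemma le_trans: "(a, b) \<in> \<kappa> \<Longrightarrow> (b, c) \<in> \<kappa> \<Longrightarrow> (a, c) \<in> \<kappa>"
  using well_order by (auto simp: order_on_defs dest: transD)

lemma le_antisym: "(a, b) \<in> \<kappa> \<Longrightarrow> (b, a) \<in> \<kappa> \<Longrightarrow> a = b"
  using well_order by (auto simp: order_on_defs dest: antisymD)

lemma le_refl: "a \<in> Field \<kappa> \<Longrightarrow> (a, a) \<in> \<kappa>"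
  using well_order by (auto simp: order_on_defs dest: refl_onD)

lemma le_or_less: "a \<in> Field \<kappa> \<Longrightarrow> b \<in> Field \<kappa> \<Longrightarrow> (a, b) \<in> \<kappa> \<or> b \<in> underS \<kappa> a"
  using well_order by (cases "a = b") (auto simp: order_on_defs total_on_def underS_def dest: refl_onD)

lemma FieldI: "(a, b) \<in> \<kappa> \<Longrightarrow> a \<in> Field \<kappa>" "(a, b) \<in> \<kappa> \<Longrightarrow> b \<in> Field \<kappa>"
  by (auto simp: Field_def)

lemma not_le_underS: "(a, b) \<in> \<kappa> \<Longrightarrow> b \<in> underS \<kappa> a \<Longrightarrow> False"
  unfolding underS_def using le_antisym by blast

lemma underS_trans1: "(a, b) \<in> \<kappa> \<Longrightarrow> b \<in> underS \<kappa> c \<Longrightarrow> a \<in> underS \<kappa> c"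
  unfolding underS_def using le_trans le_antisym by blast

lemma underS_trans2: "a \<in> underS \<kappa> b \<Longrightarrow> (b, c) \<in> \<kappa> \<Longrightarrow> a \<in> underS \<kappa> c"
  unfolding underS_def using le_trans le_antisym by blast

lemma small_mono: "A \<subseteq> B \<Longrightarrow> |B| <o \<kappa> \<Longrightarrow> |A| <o \<kappa>"
  by (rule ordLeq_ordLess_trans[OF card_of_mono1])

lemma small_image: "|A| <o \<kappa> \<Longrightarrow> |h ` A| <o \<kappa>"
  by (rule ordLeq_ordLess_trans[OF card_of_image])

lemma small_preimage:
  assumes "inj_on h A" "h ` A \<subseteq> B" "|B| <o \<kappa>"
  shows "|A| <o \<kappa>"
proof -
  have "|A| \<le>o |B|" using assms(1,2) card_of_ordLeq by blast
  then show ?thesis using assms(3) by (rule ordLeq_ordLess_trans)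
qed

lemma small_countable: "|A :: nat set| <o \<kappa>"
  by (rule small_mono[OF subset_UNIV ordIso_ordLess_trans[OF card_of_nat uncountable]])

lemma small_finite:
  assumes "finite A"
  shows "|A| <o \<kappa>"
proof -
  have "|A| <o natLeq"
    using assms by (simp add: finite_iff_ordLess_natLeq)
  then show ?thesis using uncountable by (rule ordLess_transitive)
qed

lemma small_UN: "|I| <o \<kappa> \<Longrightarrow> (\<And>i. i \<in> I \<Longrightarrow> |A i| <o \<kappa>) \<Longrightarrow> |\<Union>i\<in>I. A i| <o \<kappa>"
  by (rule card_of_UNION_ordLess_infinite_Field_regularCard[OF regular cinfinite]) auto

lemma small_Un: "|A| <o \<kappa> \<Longrightarrow> |B| <o \<kappa> \<Longrightarrow> |A \<union> B| <o \<kappa>"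
  by (rule card_of_Un_ordLess_infinite_Field[OF _ card_order])
    (use cinfinite in \<open>auto simp: cinfinite_def\<close>)

lemma small_underS: "a \<in> Field \<kappa> \<Longrightarrow> |underS \<kappa> a| <o \<kappa>"
  using card_of_underS[OF card_order] .

lemma small_under:
  assumes "a \<in> Field \<kappa>"
  shows "|under \<kappa> a| <o \<kappa>"
proof -
  have "under \<kappa> a \<subseteq> underS \<kappa> a \<union> {a}"
    by (auto simp: under_def underS_def)
  then show ?thesis
    by (rule small_mono[OF _ small_Un[OF small_underS[OF assms] small_finite]]) simp
qed

lemma small_lists:
  assumes "|A| <o \<kappa>"
  shows "|lists A| <o \<kappa>"
proof -
  have small_n: "|{xs \<in> lists A. length xs = n}| <o \<kappa>" for n
  proof (induction n)
    case 0
    have "{xs \<in> lists A. length xs = 0} = {[]}" by auto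
    then show ?case by (simp add: small_finite)
  next
    case (Suc n)
    have "{xs \<in> lists A. length xs = Suc n} \<subseteq> (\<Union>a\<in>A. Cons a ` {xs \<in> lists A. length xs = n})"
      by (fastforce simp: length_Suc_conv)
    moreover have "|\<Union>a\<in>A. Cons a ` {xs \<in> lists A. length xs = n}| <o \<kappa>"
      by (rule small_UN[OF assms small_image[OF Suc]])
    ultimately show ?case using small_mono by blast
  qed
  have "lists A = (\<Union>n. {xs \<in> lists A. length xs = n})" by auto
  then show ?thesis
    using small_UN[OF small_countable[of UNIV], of "\<lambda>n. {xs \<in> lists A. length xs = n}"] small_n
    by simp
qed

lemma not_small_Field: "\<not> |Field \<kappa>| <o \<kappa>"
  using card_of_Field_ordIso[OF card_order] not_ordLess_ordIso by blast

text \<open>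
  Regularity only forbids small sets that are cofinal, which yields a weak upper bound \<open>a\<close>. As initial
  segments are small, there are ordinals above \<open>a\<close>, so the bound can be made strict.
\<close>

lemma small_bounded:
  assumes sub: "A \<subseteq> Field \<kappa>" and small: "|A| <o \<kappa>"
  shows "\<exists>b \<in> Field \<kappa>. A \<subseteq> underS \<kappa> b"
proof -
  have "\<not> cofinal A \<kappa>"
    using regular small sub not_ordLess_ordIso unfolding regularCard_def by blast
  then obtain a where a: "a \<in> Field \<kappa>" and ub: "\<And>b. b \<in> A \<Longrightarrow> a = b \<or> (a, b) \<notin> \<kappa>"
    unfolding cofinal_def by blast
  have "\<not> Field \<kappa> \<subseteq> under \<kappa> a"
    using small_under[OF a] small_mono not_small_Field by blast
  then obtain b where b: "b \<in> Field \<kappa>" "(b, a) \<notin> \<kappa>" by (auto simp: under_def)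
  then have ab: "a \<in> underS \<kappa> b" using le_or_less a by blast
  have "x \<in> underS \<kappa> b" if "x \<in> A" for x
  proof -
    have "x = a \<or> x \<in> underS \<kappa> a"
      using ub[OF that] le_or_less[OF a, of x] that sub by blast
    then show ?thesis
      using ab underS_trans1 le_refl a by (auto simp: underS_def)
  qed
  then show ?thesis using b by blast
qed

lemma unbounded_card:
  assumes sub: "A \<subseteq> Field \<kappa>" and unb: "\<And>a. a \<in> Field \<kappa> \<Longrightarrow> \<exists>b \<in> A. (a, b) \<in> \<kappa>"
  shows "|A| =o \<kappa>"
proof -
  have "\<not> |A| <o \<kappa>"
    using small_bounded[OF sub] unb not_le_underS by blast
  moreover have "|A| \<le>o \<kappa>"
    using card_of_mono1[OF sub] card_of_Field_ordIso[OF card_order] ordLeq_ordIso_trans by blast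
  ultimately show ?thesis
    using ordLeq_iff_ordLess_or_ordIso by blast
qed

lemma least_strict_bound:
  assumes "A \<subseteq> Field \<kappa>" "|A| <o \<kappa>"
  obtains s where "s \<in> Field \<kappa>" "A \<subseteq> underS \<kappa> s" "\<And>a. a \<in> underS \<kappa> s \<Longrightarrow> \<exists>b \<in> A. (a, b) \<in> \<kappa>"
proof -
  let ?U = "{b \<in> Field \<kappa>. A \<subseteq> underS \<kappa> b}"
  have "wf (\<kappa> - Id)"
    using well_order by (auto simp: well_order_on_def)
  moreover obtain b where "b \<in> ?U" using small_bounded[OF assms] by blast
  ultimately obtain s where s: "s \<in> ?U" and min: "\<And>a. (a, s) \<in> \<kappa> - Id \<Longrightarrow> a \<notin> ?U"
    by (rule wfE_min) blast
  show ?thesis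
  proof
    fix a assume a: "a \<in> underS \<kappa> s"
    then have "a \<notin> ?U" and "a \<in> Field \<kappa>"
      using min[of a] FieldI by (auto simp: underS_def)
    then obtain b where "b \<in> A" "b \<notin> underS \<kappa> a" by blast
    then show "\<exists>b \<in> A. (a, b) \<in> \<kappa>"
      using le_or_less[OF \<open>a \<in> Field \<kappa>\<close>] assms(1) by blast
  qed (use s in auto)
qed

text \<open>
  Iterating a function that strictly bounds all values of \<open>B\<close> up to its argument gives a strictly
  increasing \<open>\<omega>\<close>-sequence, whose supremum is closed under \<open>B\<close> and has cofinality \<open>\<omega>\<close>.
\<close>

lemma stationary_cofinality_omega:
  "stationary \<kappa> {s \<in> Field \<kappa>. cofinality_omega \<kappa> s}"
  unfolding stationary_def
proof (intro allI impI)
  fix B assume B: "small_valued \<kappa> B"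
  define B' where "B' a = insert a (\<Union>b \<in> under \<kappa> a. B b)" for a
  have "\<exists>c \<in> Field \<kappa>. B' a \<subseteq> underS \<kappa> c" if a: "a \<in> Field \<kappa>" for a
  proof (rule small_bounded)
    show "B' a \<subseteq> Field \<kappa>"
      using a B by (auto simp: B'_def small_valued_def under_def dest: FieldI)
    have "|\<Union>b \<in> under \<kappa> a. B b| <o \<kappa>"
      by (rule small_UN[OF small_under[OF a]])
        (use B in \<open>auto simp: small_valued_def under_def dest: FieldI\<close>)
    then show "|B' a| <o \<kappa>"
      unfolding B'_def using small_Un[of "{a}", OF small_finite] by simp
  qed
  then obtain N where N: "\<And>a. a \<in> Field \<kappa> \<Longrightarrow> N a \<in> Field \<kappa>"
    and NB: "\<And>a. a \<in> Field \<kappa> \<Longrightarrow> B' a \<subseteq> underS \<kappa> (N a)"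
    by metis
  obtain z where z: "z \<in> Field \<kappa>"
    using small_bounded[of "{}"] by (auto simp: small_finite)
  define c where "c n = (N ^^ n) z" for n
  have cF: "c n \<in> Field \<kappa>" for n
    by (induction n) (auto simp: c_def z N)
  have cB: "B' (c n) \<subseteq> underS \<kappa> (c (Suc n))" for n
    using NB[OF cF[of n]] by (simp add: c_def)
  have c_Suc: "c n \<in> underS \<kappa> (c (Suc n))" for n
    using cB[of n] by (auto simp: B'_def)
  have c_less: "c m \<in> underS \<kappa> (c n)" if "m < n" for m n
    using that
  proof (induction n)
    case (Suc n)
    then have "(c m, c n) \<in> \<kappa>"
      using le_refl[OF cF] by (cases "m = n") (auto simp: underS_def)
    then show ?case using underS_trans1 c_Suc by blast
  qed simp
  have inj: "inj c"
    using c_less by (metis injI linorder_neqE_nat underS_notIn)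
  obtain s where s: "s \<in> Field \<kappa>" and below: "range c \<subseteq> underS \<kappa> s"
    and cof: "\<And>a. a \<in> underS \<kappa> s \<Longrightarrow> \<exists>b \<in> range c. (a, b) \<in> \<kappa>"
    using least_strict_bound[of "range c"] cF small_image[OF small_countable] by blast
  have "cofinality_omega \<kappa> s"
    unfolding cofinality_omega_def
  proof (intro conjI allI impI)
    have "|range c| =o natLeq"
      using inj card_of_ordIso[of UNIV "range c"] card_of_nat ordIso_symmetric ordIso_transitive
      by (metis inj_on_imp_bij_betw)
    then show "\<exists>A. cofinal_below \<kappa> s A \<and> |A| =o natLeq"
      using below cof unfolding cofinal_below_def by blast
  next
    fix A assume A: "cofinal_below \<kappa> s A"
    have "\<exists>n. \<forall>a \<in> F. a \<in> underS \<kappa> (c n)" if "finite F" "F \<subseteq> A" for F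
      using that
    proof (induction F)
      case (insert x F)
      then obtain n where n: "\<forall>a \<in> F. a \<in> underS \<kappa> (c n)" by blast
      have "x \<in> underS \<kappa> s"
        using A insert.prems by (auto simp: cofinal_below_def)
      then obtain m where m: "(x, c m) \<in> \<kappa>"
        using cof by blast
      have "(c n, c (Suc (max m n))) \<in> \<kappa>" "c m \<in> underS \<kappa> (c (Suc (max m n)))"
        using c_less[of n "Suc (max m n)"] c_less[of m "Suc (max m n)"]
        by (auto simp: underS_def)
      then have "\<forall>a \<in> insert x F. a \<in> underS \<kappa> (c (Suc (max m n)))"
        using m n underS_trans1 underS_trans2 by blast
      then show ?case by blast
    qed simp
    moreover have "\<exists>a \<in> A. (c n, a) \<in> \<kappa>" for n
      using A below by (auto simp: cofinal_below_def)
    ultimately have "infinite A"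
      using not_le_underS by (metis order_refl)
    then show "natLeq \<le>o |A|"
      using infinite_iff_natLeq_ordLeq by blast
  qed
  moreover have "closed_at \<kappa> B s"
    unfolding closed_at_def
  proof
    fix b assume "b \<in> underS \<kappa> s"
    then obtain n where "(b, c n) \<in> \<kappa>" using cof by blast
    then have "B b \<subseteq> underS \<kappa> (c (Suc n))"
      using cB[of n] by (auto simp: B'_def under_def)
    moreover have "(c (Suc n), s) \<in> \<kappa>" using below by (auto simp: underS_def)
    ultimately show "B b \<subseteq> underS \<kappa> s" using underS_trans2 by blast
  qed
  ultimately show "\<exists>s \<in> {s \<in> Field \<kappa>. cofinality_omega \<kappa> s}. closed_at \<kappa> B s"
    using s by blast
qed

text \<open>
  Fodor's lemma. If the fibre over every \<open>c\<close> misses the points closed under some \<open>B c\<close>, then a point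
  closed under the diagonal operation \<open>D\<close> is closed under \<open>B c\<close> for all smaller \<open>c\<close>, in particular
  for \<open>c = h s\<close>.
\<close>

lemma pressing_down:
  assumes W: "stationary \<kappa> W" "W \<subseteq> Field \<kappa>"
    and regressive: "\<And>s. s \<in> W \<Longrightarrow> h s \<in> underS \<kappa> s"
  shows "\<exists>c. stationary \<kappa> {s \<in> W. h s = c}"
proof (rule ccontr)
  assume "\<not> ?thesis"
  then have "\<forall>c. \<exists>B. small_valued \<kappa> B \<and> (\<forall>s \<in> W. h s = c \<longrightarrow> \<not> closed_at \<kappa> B s)"
    unfolding stationary_def by blast
  then obtain B where B: "\<And>c. small_valued \<kappa> (B c)"
    and nc: "\<And>s. s \<in> W \<Longrightarrow> \<not> closed_at \<kappa> (B (h s)) s"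
    by metis
  define D where "D a = (\<Union>c \<in> under \<kappa> a. \<Union>b \<in> under \<kappa> a. B c b)" for a
  have "small_valued \<kappa> D"
    unfolding small_valued_def
  proof (intro ballI conjI)
    fix a assume a: "a \<in> Field \<kappa>"
    show "D a \<subseteq> Field \<kappa>"
      using B by (auto simp: D_def small_valued_def under_def dest: FieldI)
    show "|D a| <o \<kappa>"
      unfolding D_def
      by (intro small_UN small_under a)
        (use B in \<open>auto simp: small_valued_def under_def dest: FieldI\<close>)
  qed
  then obtain s where s: "s \<in> W" and closed: "closed_at \<kappa> D s"
    using W(1) unfolding stationary_def by blast
  have "closed_at \<kappa> (B (h s)) s"
    unfolding closed_at_def
  proof
    fix b assume b: "b \<in> underS \<kappa> s"
    have hs: "h s \<in> underS \<kappa> s" using regressive[OF s] .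
    have F: "h s \<in> Field \<kappa>" "b \<in> Field \<kappa>"
      using b hs by (auto simp: underS_def dest: FieldI)
    then have "(h s, b) \<in> \<kappa> \<or> (b, h s) \<in> \<kappa>"
      using le_or_less by (auto simp: underS_def)
    then have "\<exists>m \<in> {h s, b}. (h s, m) \<in> \<kappa> \<and> (b, m) \<in> \<kappa>"
      using F le_refl by blast
    then obtain m where m: "m \<in> underS \<kappa> s" "(h s, m) \<in> \<kappa>" "(b, m) \<in> \<kappa>"
      using b hs by blast
    then have "B (h s) b \<subseteq> D m" by (auto simp: D_def under_def)
    then show "B (h s) b \<subseteq> underS \<kappa> s"
      using closed m(1) unfolding closed_at_def by blast
  qed
  then show False using nc[OF s] by blast
qed

text \<open>
  Otherwise, for each \<open>n\<close>, the \<open>n\<close>-th entries are bounded by some \<open>a n\<close> on the part of \<open>W\<close> in a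
  club. The countably many \<open>a n\<close> have a common bound \<open>b\<close>, and at a point \<open>s > b\<close> of \<open>W\<close> in
  the intersection of the clubs all entries stay below \<open>b\<close>, so they are not cofinal in \<open>s\<close>.
\<close>

lemma stationary_ladder_entry:
  fixes f :: "'a \<Rightarrow> nat \<Rightarrow> 'a"
  assumes W: "stationary \<kappa> W"
    and ladder: "\<And>s. s \<in> W \<Longrightarrow> cofinal_below \<kappa> s (range (f s))"
  shows "\<exists>n. \<forall>a \<in> Field \<kappa>. stationary \<kappa> {s \<in> W. (a, f s n) \<in> \<kappa>}"
proof (rule ccontr)
  assume "\<not> ?thesis"
  then have "\<forall>n. \<exists>a B. a \<in> Field \<kappa> \<and> small_valued \<kappa> B \<and>
      (\<forall>s \<in> W. (a, f s n) \<in> \<kappa> \<longrightarrow> \<not> closed_at \<kappa> B s)"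
    unfolding stationary_def by blast
  then obtain a B where a: "\<And>n. a n \<in> Field \<kappa>" and B: "\<And>n. small_valued \<kappa> (B n)"
    and nc: "\<And>n s. s \<in> W \<Longrightarrow> (a n, f s n) \<in> \<kappa> \<Longrightarrow> \<not> closed_at \<kappa> (B n) s"
    by metis
  obtain b where b: "b \<in> Field \<kappa>" and ab: "range a \<subseteq> underS \<kappa> b"
    using small_bounded[of "range a"] a small_image[OF small_countable] by blast
  \<comment> \<open>The value \<open>b\<close> is added to force closed points above \<open>b\<close>.\<close>
  define D where "D x = insert b (\<Union>n. B n x)" for x
  have "small_valued \<kappa> D"
    unfolding small_valued_def
  proof (intro ballI conjI)
    fix x assume x: "x \<in> Field \<kappa>"
    show "D x \<subseteq> Field \<kappa>"
      using B b x by (auto simp: D_def small_valued_def)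
    have "|\<Union>n. B n x| <o \<kappa>"
      by (rule small_UN[OF small_countable]) (use B x in \<open>auto simp: small_valued_def\<close>)
    then show "|D x| <o \<kappa>"
      unfolding D_def using small_Un[of "{b}", OF small_finite] by simp
  qed
  then obtain s where s: "s \<in> W" and closed: "closed_at \<kappa> D s"
    using W unfolding stationary_def by blast
  have "f s 0 \<in> underS \<kappa> s"
    using ladder[OF s] by (auto simp: cofinal_below_def)
  then have "b \<in> underS \<kappa> s"
    using closed by (auto simp: closed_at_def D_def)
  then obtain n where "(b, f s n) \<in> \<kappa>"
    using ladder[OF s] by (auto simp: cofinal_below_def)
  moreover have "(a n, b) \<in> \<kappa>" using ab by (auto simp: underS_def)
  ultimately have "(a n, f s n) \<in> \<kappa>" using le_trans by blast
  moreover have "closed_at \<kappa> (B n) s"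
    using closed by (auto simp: closed_at_def D_def)
  ultimately show False using nc[OF s] by blast
qed

text \<open>
  The fibres of \<open>s \<mapsto> f s n\<close> are disjoint. Pressing down on the sets of \<open>stationary_ladder_entry\<close> makes the
  fibres over unboundedly many values stationary, and by regularity these values are \<open>\<kappa>\<close> many.
\<close>

lemma stationary_split:
  fixes f :: "'a \<Rightarrow> nat \<Rightarrow> 'a"
  assumes W: "stationary \<kappa> W" "W \<subseteq> Field \<kappa>"
    and ladder: "\<And>s. s \<in> W \<Longrightarrow> cofinal_below \<kappa> s (range (f s))"
  shows "\<exists>T. (\<forall>i \<in> Field \<kappa>. T i \<subseteq> W \<and> stationary \<kappa> (T i)) \<and>
    (\<forall>i \<in> Field \<kappa>. \<forall>j \<in> Field \<kappa>. i \<noteq> j \<longrightarrow> T i \<inter> T j = {})"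
proof -
  obtain n where n: "\<And>a. a \<in> Field \<kappa> \<Longrightarrow> stationary \<kappa> {s \<in> W. (a, f s n) \<in> \<kappa>}"
    using stationary_ladder_entry[OF W(1) ladder] by blast
  define C where "C = {c \<in> Field \<kappa>. stationary \<kappa> {s \<in> W. f s n = c}}"
  have "\<exists>c \<in> C. (a, c) \<in> \<kappa>" if a: "a \<in> Field \<kappa>" for a
  proof -
    let ?W = "{s \<in> W. (a, f s n) \<in> \<kappa>}"
    have "\<exists>c. stationary \<kappa> {s \<in> ?W. f s n = c}"
      by (rule pressing_down[OF n[OF a]]) (use W ladder in \<open>auto simp: cofinal_below_def image_subset_iff\<close>)
    then obtain c where c: "stationary \<kappa> {s \<in> ?W. f s n = c}" by blast
    have "small_valued \<kappa> (\<lambda>_. {})"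
      by (simp add: small_valued_def small_finite)
    then obtain s where "s \<in> ?W" "f s n = c"
      using c unfolding stationary_def by blast
    then have "(a, c) \<in> \<kappa>" by blast
    moreover have "stationary \<kappa> {s \<in> W. f s n = c}"
      by (rule stationary_mono[OF c]) blast
    ultimately show ?thesis unfolding C_def using FieldI by blast
  qed
  then have "|C| =o \<kappa>"
    by (rule unbounded_card[rotated]) (auto simp: C_def)
  then have "|Field \<kappa>| =o |C|"
    using card_of_Field_ordIso[OF card_order] ordIso_symmetric ordIso_transitive by blast
  then obtain g where g: "bij_betw g (Field \<kappa>) C"
    using card_of_ordIso by blast
  show ?thesis
  proof (intro exI[of _ "\<lambda>i. {s \<in> W. f s n = g i}"] conjI ballI impI)
    fix i assume i: "i \<in> Field \<kappa>"
    show "{s \<in> W. f s n = g i} \<subseteq> W" by blast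
    show "stationary \<kappa> {s \<in> W. f s n = g i}"
      using g i by (auto simp: C_def bij_betw_def)
  next
    fix i j assume "i \<in> Field \<kappa>" "j \<in> Field \<kappa>" "i \<noteq> j"
    then show "{s \<in> W. f s n = g i} \<inter> {s \<in> W. f s n = g j} = {}"
      using g by (auto simp: bij_betw_def inj_on_def)
  qed
qed

lemma ladders_inj:
  fixes f :: "'a \<Rightarrow> nat \<Rightarrow> 'a"
  assumes W: "W \<subseteq> Field \<kappa>"
    and ladder: "\<And>s. s \<in> W \<Longrightarrow> cofinal_below \<kappa> s (range (f s))"
  shows "inj_on f W"
proof (rule inj_onI)
  fix s r assume sr: "s \<in> W" "r \<in> W" "f s = f r"
  have no_less: "r \<notin> underS \<kappa> s" if sr: "s \<in> W" "r \<in> W" "f s = f r" for s r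
  proof
    assume "r \<in> underS \<kappa> s"
    then obtain n where "(r, f s n) \<in> \<kappa>"
      using ladder[OF sr(1)] by (auto simp: cofinal_below_def)
    moreover have "f s n \<in> underS \<kappa> r"
      using ladder[OF sr(2)] sr(3) by (auto simp: cofinal_below_def)
    ultimately show False using not_le_underS by blast
  qed
  have "(s, r) \<in> \<kappa>" "(r, s) \<in> \<kappa>"
    using le_or_less no_less sr W by (metis subsetD)+
  then show "s = r" using le_antisym by blast
qed

lemma stationary_many_tops:
  fixes f :: "'a \<Rightarrow> nat \<Rightarrow> 'a"
  assumes W: "stationary \<kappa> W" "W \<subseteq> Field \<kappa>"
    and ladder: "\<And>s. s \<in> W \<Longrightarrow> cofinal_below \<kappa> s (range (f s))"
  shows "|f ` W| =o \<kappa>"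
proof -
  have "|W| =o \<kappa>"
  proof (rule unbounded_card[OF W(2)])
    fix a assume a: "a \<in> Field \<kappa>"
    have "small_valued \<kappa> (\<lambda>_. {a})"
      using a by (simp add: small_valued_def small_finite)
    then obtain s where s: "s \<in> W" "closed_at \<kappa> (\<lambda>_. {a}) s"
      using W(1) unfolding stationary_def by blast
    have "f s 0 \<in> underS \<kappa> s"
      using ladder[OF s(1)] by (auto simp: cofinal_below_def)
    then have "a \<in> underS \<kappa> s"
      using s(2) by (auto simp: closed_at_def)
    then show "\<exists>b \<in> W. (a, b) \<in> \<kappa>" using s by (auto simp: underS_def)
  qed
  moreover have "inj_on f W"
    using W(2) ladder by (rule ladders_inj)
  ultimately show ?thesis
    using card_of_ordIso[of W "f ` W"] ordIso_symmetric ordIso_transitive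
    by (metis inj_on_imp_bij_betw)
qed

section \<open>Minors between trees with tops\<close>

text \<open>
  A finite subset of \<open>s\<close> is not cofinal, so some element of \<open>s\<close> is above all its members. This places
  each finite sequence over \<open>s\<close> among the sequences over the ordinals up to a single \<open>b < s\<close>, where
  closure under an operation applies.
\<close>

lemma finite_bounded_below_cofinality_omega:
  assumes s: "cofinality_omega \<kappa> s" "s \<in> Field \<kappa>" and F: "finite F" "F \<subseteq> underS \<kappa> s"
  shows "\<exists>b \<in> underS \<kappa> s. F \<subseteq> under \<kappa> b"
proof -
  have "\<not> natLeq \<le>o |F|"
    using F(1) infinite_iff_natLeq_ordLeq by blast
  then have "\<not> cofinal_below \<kappa> s F"
    using s(1) by (auto simp: cofinality_omega_def)
  then obtain b where b: "b \<in> underS \<kappa> s" and nb: "\<And>x. x \<in> F \<Longrightarrow> (b, x) \<notin> \<kappa>"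
    using F(2) by (auto simp: cofinal_below_def)
  have "x \<in> under \<kappa> b" if "x \<in> F" for x
    using nb[OF that] le_or_less[of b x] F(2) b that
    by (auto simp: underS_def under_def dest: FieldI)
  then show ?thesis using b by blast
qed

text \<open>
  In place of the club described at the beginning there is an operation \<open>B\<close>. Its values are small
  because there are few finite sequences over an initial segment and because \<open>t\<close> is injective, so that
  few tops can be sent to sequences over such a segment or to tops with index in it.
\<close>

lemma minor_tops_difference_nonstationary:
  assumes S: "tops_data \<kappa> S f" and R: "tops_data \<kappa> R g"
    and minor: "tree_with_tops \<kappa> S f \<preceq>\<^sub>m tree_with_tops \<kappa> R g"
  shows "\<not> stationary \<kappa> (S - R)"
proof
  assume stat: "stationary \<kappa> (S - R)"
  let ?H = "tree_with_tops \<kappa> S f" and ?G = "tree_with_tops \<kappa> R g"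
  let ?L = "lists (Field \<kappa>)"
  have H: "pair_wf_digraph ?H"
    by (intro pair_loopfree_digraph.axioms(1) pair_bidirected_digraph.axioms(2)
        tree_with_tops_simple_graph[OF S])
  have comp_G: "\<And>u v. (u, v) \<in> parcs ?G \<Longrightarrow> tree_comparable u v"
    by (rule tree_arcs_comparable)
  obtain t where inj: "inj_on t (pverts ?H)" and into: "\<And>x. x \<in> pverts ?H \<Longrightarrow> t x \<in> pverts ?G"
    and adj: "\<And>x y. (x, y) \<in> parcs ?H \<Longrightarrow> tree_comparable (t x) (t y)"
    using minor_root_map[OF comp_G H minor] by blast
  have vH: "pverts ?H = Fin ` ?L \<union> Top ` f ` S" and vG: "pverts ?G = Fin ` ?L \<union> Top ` g ` R"
    by (simp_all add: tree_with_tops_def Let_def)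
  have fF: "f s n \<in> underS \<kappa> s" if "s \<in> S" for s n
    using S that by (auto simp: tops_data_def cofinal_below_def image_subset_iff)
  have underS_Field': "underS \<kappa> s \<subseteq> Field \<kappa>" for s
    by (auto simp: underS_def dest: FieldI)
  \<comment> \<open>The images of the \<open>\<kappa>\<close> many extensions of \<open>xs\<close> by one entry would lie strictly below the
    top, where there are only countably many vertices.\<close>
  have not_top: "t (Fin xs) \<noteq> Top h" if xs: "xs \<in> ?L" for xs h
  proof
    assume top: "t (Fin xs) = Top h"
    let ?c = "\<lambda>a. t (Fin (xs @ [a]))"
    have "?c a \<in> (\<lambda>n. Fin (map h [0..<n])) ` UNIV" if a: "a \<in> Field \<kappa>" for a
    proof -
      have "(Fin xs, Fin (xs @ [a])) \<in> parcs ?H"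
        using xs a by (auto simp: tree_with_tops_def Let_def)
      from adj[OF this] have "tree_comparable (Top h) (?c a)" using top by simp
      moreover have "?c a \<noteq> Top h"
      proof
        assume "?c a = Top h"
        then have "?c a = t (Fin xs)"
          using top by simp
        then have "Fin (xs @ [a]) = Fin xs"
          by (rule inj_onD[OF inj]) (use xs a in \<open>auto simp: vH\<close>)
        then show False by simp
      qed
      ultimately obtain ys where "?c a = Fin ys" "ys = map h [0..<length ys]"
        by (cases "?c a") (auto simp: tree_comparable_def)
      then show ?thesis by (metis rangeI)
    qed
    moreover have "inj_on ?c (Field \<kappa>)"
    proof (rule inj_onI)
      fix a b assume ab: "a \<in> Field \<kappa>" "b \<in> Field \<kappa>" "?c a = ?c b"
      have "Fin (xs @ [a]) = Fin (xs @ [b])"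
        by (rule inj_onD[OF inj ab(3)]) (use xs ab in \<open>auto simp: vH\<close>)
      then show "a = b" by simp
    qed
    ultimately have "|Field \<kappa>| <o \<kappa>"
      by (intro small_preimage[of ?c, OF _ _ small_image[OF small_countable[of UNIV]]]) auto
    then show False using not_small_Field by blast
  qed
  have "\<exists>ys. t (Fin xs) = Fin ys \<and> ys \<in> ?L" if "xs \<in> ?L" for xs
  proof -
    have "t (Fin xs) \<in> pverts ?G" using that by (intro into) (simp add: vH)
    then show ?thesis using not_top[OF that] unfolding vG by auto
  qed
  then obtain \<tau> where \<tau>: "\<And>xs. xs \<in> ?L \<Longrightarrow> t (Fin xs) = Fin (\<tau> xs)"
    and \<tau>_lists: "\<And>xs. xs \<in> ?L \<Longrightarrow> \<tau> xs \<in> ?L"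
    by metis
  \<comment> \<open>The first part keeps \<open>\<tau>\<close> inside the sequences over a closed point. The second part makes
    the image of the top of a closed point \<open>s\<close> avoid the sequences over \<open>s\<close> and the tops with index below \<open>s\<close>.\<close>
  define B where "B b = (\<Union>xs \<in> lists (under \<kappa> b). set (\<tau> xs)) \<union>
    {s \<in> S. t (Top (f s)) \<in> Fin ` lists (under \<kappa> b) \<union> Top ` g ` under \<kappa> b}" for b
  have inj_f: "inj_on (\<lambda>s. t (Top (f s))) S"
  proof (rule inj_onI)
    have inj_S: "inj_on f S"
      using S by (intro ladders_inj) (auto simp: tops_data_def)
    fix s r assume sr: "s \<in> S" "r \<in> S" "t (Top (f s)) = t (Top (f r))"
    have "Top (f s) = Top (f r)"
      by (rule inj_onD[OF inj sr(3)]) (use sr in \<open>auto simp: vH\<close>)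
    then show "s = r" using inj_onD[OF inj_S _ sr(1,2)] by simp
  qed
  have under_lists: "lists (under \<kappa> b) \<subseteq> ?L" for b
    by (intro lists_mono) (auto simp: under_def dest: FieldI)
  have "small_valued \<kappa> B"
    unfolding small_valued_def
  proof (intro ballI conjI)
    fix b assume b: "b \<in> Field \<kappa>"
    show "B b \<subseteq> Field \<kappa>"
    proof -
      have "set (\<tau> xs) \<subseteq> Field \<kappa>" if "xs \<in> lists (under \<kappa> b)" for xs
        using \<tau>_lists[of xs] under_lists[of b] that by auto
      moreover have "S \<subseteq> Field \<kappa>"
        using S by (simp add: tops_data_def)
      ultimately show ?thesis
        unfolding B_def by blast
    qed
    have "|\<Union>xs \<in> lists (under \<kappa> b). set (\<tau> xs)| <o \<kappa>"
      by (intro small_UN small_lists small_under b small_finite) auto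
    moreover have "|{s \<in> S. t (Top (f s)) \<in> Fin ` lists (under \<kappa> b) \<union> Top ` g ` under \<kappa> b}| <o \<kappa>"
    proof (rule small_preimage)
      show "inj_on (\<lambda>s. t (Top (f s)))
          {s \<in> S. t (Top (f s)) \<in> Fin ` lists (under \<kappa> b) \<union> Top ` g ` under \<kappa> b}"
        using inj_f by (rule inj_on_subset) blast
      show "|Fin ` lists (under \<kappa> b) \<union> Top ` g ` under \<kappa> b| <o \<kappa>"
        by (intro small_Un small_image small_lists small_under b)
    qed blast
    ultimately show "|B b| <o \<kappa>"
      unfolding B_def by (rule small_Un)
  qed
  then obtain s where s: "s \<in> S" "s \<notin> R" and closed: "closed_at \<kappa> B s"
    using stat unfolding stationary_def by blast
  have sF: "s \<in> Field \<kappa>" and cof: "cofinality_omega \<kappa> s"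
    using S s by (auto simp: tops_data_def)
  have below: "\<exists>b \<in> underS \<kappa> s. xs \<in> lists (under \<kappa> b)" if "xs \<in> lists (underS \<kappa> s)" for xs
    using finite_bounded_below_cofinality_omega[OF cof sF, of "set xs"] that
    by (auto simp: in_lists_conv_set subset_iff)
  have \<tau>_below: "\<tau> xs \<in> lists (underS \<kappa> s)" if xs: "xs \<in> lists (underS \<kappa> s)" for xs
  proof -
    obtain b where "b \<in> underS \<kappa> s" "xs \<in> lists (under \<kappa> b)" using below[OF xs] by blast
    moreover from this have "B b \<subseteq> underS \<kappa> s" using closed by (auto simp: closed_at_def)
    ultimately show ?thesis unfolding B_def by blast
  qed
  have not_B: "s \<notin> B b" if "b \<in> underS \<kappa> s" for b
    using closed that underS_notIn unfolding closed_at_def by fast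
  have not_Fin: "t (Top (f s)) \<notin> Fin ` lists (underS \<kappa> s)"
    using below not_B s(1) unfolding B_def by blast
  have not_Top: "t (Top (f s)) \<notin> Top ` g ` underS \<kappa> s"
    using not_B s(1) le_refl underS_Field'[of s] unfolding B_def under_def by blast
  define p where "p n = \<tau> (map (f s) [0..<n])" for n
  have seg: "map (f s) [0..<n] \<in> lists (underS \<kappa> s)" for n
    using fF[OF s(1)] by auto
  have seg': "map (f s) [0..<n] \<in> ?L" for n
    using seg underS_Field'[of s] by auto
  have p_below: "p n \<in> lists (underS \<kappa> s)" for n
    unfolding p_def by (rule \<tau>_below[OF seg])
  have t_seg: "t (Fin (map (f s) [0..<n])) = Fin (p n)" for n
    using \<tau>[OF seg'] by (simp add: p_def)
  have inj_p: "inj p"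
  proof (rule injI)
    fix m n assume "p m = p n"
    then have "Fin (map (f s) [0..<m]) = Fin (map (f s) [0..<n])"
      using inj_onD[OF inj, of "Fin (map (f s) [0..<m])" "Fin (map (f s) [0..<n])"] seg' t_seg
      by (simp add: vH)
    then have "map (f s) [0..<m] = map (f s) [0..<n]" by simp
    from map_eq_imp_length_eq[OF this] show "m = n" by simp
  qed
  have comp: "tree_comparable (t (Top (f s))) (Fin (p n))" for n
  proof -
    have "(Top (f s), Fin (map (f s) [0..<n])) \<in> parcs ?H"
      using s(1) by (auto simp: tree_with_tops_def Let_def)
    from adj[OF this] show ?thesis by (simp add: t_seg)
  qed
  have "t (Top (f s)) \<in> pverts ?G" using s(1) by (intro into) (simp add: vH)
  then consider (fin) ys where "t (Top (f s)) = Fin ys" | (top) r where "r \<in> R" "t (Top (f s)) = Top (g r)"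
    unfolding vG by blast
  then show False
  proof cases
    case fin
    \<comment> \<open>As \<open>ys\<close> is not over \<open>s\<close>, it lies above all \<open>p n\<close>, which are infinitely many.\<close>
    have "prefix (p n) ys" for n
    proof -
      have "\<not> prefix ys (p n)"
      proof
        assume "prefix ys (p n)"
        then have "ys \<in> lists (underS \<kappa> s)"
          using p_below[of n] by (auto simp: prefix_def)
        then show False using not_Fin fin by blast
      qed
      then show ?thesis using comp[of n] fin by (simp add: tree_comparable_def)
    qed
    then have "range p \<subseteq> set (prefixes ys)" by auto
    then have "finite (range p)" by (rule finite_subset) simp
    then show False using inj_p finite_imageD by blast
  next
    case top
    have p_g: "p n = map (g r) [0..<length (p n)]" for n
      using comp[of n] top by (simp add: tree_comparable_def)
    \<comment> \<open>The segments \<open>p n\<close> of \<open>g r\<close> are distinct, hence arbitrarily long.\<close>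
    have g_below: "g r k \<in> underS \<kappa> s" for k
    proof -
      have "\<exists>n. k < length (p n)"
      proof (rule ccontr)
        assume "\<not> ?thesis"
        then have "length (p n) \<in> {..k}" for n
          by (simp add: not_less)
        then have "range p \<subseteq> (\<lambda>m. map (g r) [0..<m]) ` {..k}"
          using p_g by blast
        then have "finite (range p)" by (rule finite_subset) simp
        then show False using inj_p finite_imageD by blast
      qed
      then obtain n where n: "k < length (p n)" by blast
      then have "map (g r) [0..<length (p n)] ! k = g r k" by simp
      then have "g r k \<in> set (p n)"
        using n p_g[of n] by (metis nth_mem)
      then show ?thesis using p_below[of n] by auto
    qed
    have rF: "r \<in> Field \<kappa>" and r: "cofinal_below \<kappa> r (range (g r))"
      using R top(1) by (auto simp: tops_data_def)
    have "s \<notin> underS \<kappa> r"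
    proof
      assume "s \<in> underS \<kappa> r"
      then obtain k where "(s, g r k) \<in> \<kappa>" using r by (auto simp: cofinal_below_def)
      then show False using g_below not_le_underS by blast
    qed
    then have "r \<in> underS \<kappa> s"
      using le_or_less[OF rF sF] top(1) s(2) by (auto simp: underS_def)
    then show False using not_Top top(2) by blast
  qed
qed

end

section \<open>The antichain\<close>

theorem theorem1:
  fixes \<kappa> :: "'a rel"
  assumes "Card_order \<kappa>" and "natLeq <o \<kappa>" and "regularCard \<kappa>"
  shows "\<exists>G :: 'a \<Rightarrow> 'a tree_vertex pair_pre_digraph.
           (\<forall>i \<in> Field \<kappa>. G i \<in> regular_trees_with_many_tops \<kappa>) \<and>
           (\<forall>i \<in> Field \<kappa>. \<forall>j \<in> Field \<kappa>. i \<noteq> j \<longrightarrow> \<not> G i \<preceq>\<^sub>m G j)"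
proof -
  interpret regular_uncountable \<kappa>
    using assms by unfold_locales
  define E where "E = {s \<in> Field \<kappa>. cofinality_omega \<kappa> s}"
  have "\<exists>h :: nat \<Rightarrow> 'a. cofinal_below \<kappa> s (range h)" if "s \<in> E" for s
  proof -
    obtain A where A: "cofinal_below \<kappa> s A" "|A| =o natLeq"
      using \<open>s \<in> E\<close> by (auto simp: E_def cofinality_omega_def)
    have "|UNIV :: nat set| =o |A|"
      using A(2) card_of_nat ordIso_symmetric ordIso_transitive by blast
    then obtain h :: "nat \<Rightarrow> 'a" where "bij_betw h UNIV A"
      using card_of_ordIso by blast
    then show ?thesis using A(1) by (metis bij_betw_imp_surj_on)
  qed
  then obtain f :: "'a \<Rightarrow> nat \<Rightarrow> 'a" where f: "\<And>s. s \<in> E \<Longrightarrow> cofinal_below \<kappa> s (range (f s))"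
    by metis
  have E: "stationary \<kappa> E" "E \<subseteq> Field \<kappa>"
    using stationary_cofinality_omega by (auto simp: E_def)
  have "\<exists>T. (\<forall>i \<in> Field \<kappa>. T i \<subseteq> E \<and> stationary \<kappa> (T i)) \<and>
      (\<forall>i \<in> Field \<kappa>. \<forall>j \<in> Field \<kappa>. i \<noteq> j \<longrightarrow> T i \<inter> T j = {})"
    using E f by (rule stationary_split)
  then obtain T where T: "\<forall>i \<in> Field \<kappa>. T i \<subseteq> E \<and> stationary \<kappa> (T i)"
    and disjoint: "\<forall>i \<in> Field \<kappa>. \<forall>j \<in> Field \<kappa>. i \<noteq> j \<longrightarrow> T i \<inter> T j = {}"
    by (elim exE conjE)
  have tops: "tops_data \<kappa> (T i) f" if "i \<in> Field \<kappa>" for i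
    using T that f unfolding tops_data_def E_def by blast
  show ?thesis
  proof (intro exI[of _ "\<lambda>i. tree_with_tops \<kappa> (T i) f"] conjI ballI impI)
    fix i assume i: "i \<in> Field \<kappa>"
    have "|f ` T i| =o \<kappa>"
      using T i f E(2) by (intro stationary_many_tops) blast+
    then show "tree_with_tops \<kappa> (T i) f \<in> regular_trees_with_many_tops \<kappa>"
      using tops[OF i] unfolding regular_trees_with_many_tops_def by blast
  next
    fix i j assume ij: "i \<in> Field \<kappa>" "j \<in> Field \<kappa>" "i \<noteq> j"
    then have "T i - T j = T i" using disjoint by blast
    then show "\<not> tree_with_tops \<kappa> (T i) f \<preceq>\<^sub>m tree_with_tops \<kappa> (T j) f"
      using minor_tops_difference_nonstationary[OF tops[OF ij(1)] tops[OF ij(2)]] T ij(1)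
      by auto
  qed
qed

end
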